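(* (1) $\mathcal H_0$ is dense in $(1,\infty)$. (2) If there exists an integer $n\ge1$ such that $\mathcal H_n$ is dense in $(1,\infty)$, then $\mathcal H_1$ is also dense in $(1,\infty)$. (3) If $\mathcal H_1$ is discrete (i.e. has no limit point), then $\mathcal H_n$ is discrete for all integers $n\ge1$.
   Context: A Perron number is a real algebraic integer $\beta>0$ strictly larger in modulus than all its other Galois conjugates; $\mathbb P$ denotes the set of Perron numbers. For real $\beta>1$, $T_\beta(x)=\beta x\bmod1$, and $\beta$ is a Parry number if the orbit $\{T_\beta^k(1)\}_{k\ge1}$ is finite. The Parry order of a Perron number $\beta$ is $\mathrm{Ord}_P(\beta)=\max\{n\in\mathbb N:\beta^n\text{ is Parry}\}$, with value $0$ if no positive power of $\beta$ is Parry and $\infty$ if $\beta$ is a Pisot or Salem number. $\mathcal H_n=\{\beta\in\mathbb P:\mathrm{Ord}_P(\beta)=n\}$. *)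

theory Defs
  imports "HOL-Analysis.Analysis" "HOL-Computational_Algebra.Computational_Algebra"
    "HOL-Library.Extended_Nat"
begin

(* z is a root of the minimal polynomial of x over the rationals; an irreducible rational
   polynomial vanishing at x is that minimal polynomial up to a constant factor. *)
definition galois_conjugate :: "complex \<Rightarrow> complex \<Rightarrow> bool" where
  "galois_conjugate x z \<longleftrightarrow>
     (\<exists>p :: rat poly. irreducible p \<and> poly (map_poly of_rat p) x = 0 \<and> poly (map_poly of_rat p) z = 0)"

definition other_conjugates :: "real \<Rightarrow> complex set" where
  "other_conjugates \<beta> = {z. galois_conjugate (of_real \<beta>) z \<and> z \<noteq> of_real \<beta>}"

definition perron :: "real \<Rightarrow> bool" where
  "perron \<beta> \<longleftrightarrow> algebraic_int \<beta> \<and> \<beta> > 0 \<and> (\<forall>z\<in>other_conjugates \<beta>. norm z < \<bar>\<beta>\<bar>)"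

definition pisot :: "real \<Rightarrow> bool" where
  "pisot \<beta> \<longleftrightarrow> algebraic_int \<beta> \<and> \<beta> > 1 \<and> (\<forall>z\<in>other_conjugates \<beta>. norm z < 1)"

definition salem :: "real \<Rightarrow> bool" where
  "salem \<beta> \<longleftrightarrow> algebraic_int \<beta> \<and> \<beta> > 1 \<and> (\<forall>z\<in>other_conjugates \<beta>. norm z \<le> 1) \<and>
     (\<exists>z\<in>other_conjugates \<beta>. norm z = 1)"

definition beta_map :: "real \<Rightarrow> real \<Rightarrow> real" where
  "beta_map \<beta> x = frac (\<beta> * x)"

definition parry :: "real \<Rightarrow> bool" where
  "parry \<beta> \<longleftrightarrow> \<beta> > 1 \<and> finite {(beta_map \<beta> ^^ k) 1 | k. k \<ge> 1}"

(* In enat, Sup {} = 0 and the Sup of a finite nonempty set is its maximum, so the second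
   branch is the largest n with \<beta> ^ n Parry, and 0 if there is none. *)
definition parry_order :: "real \<Rightarrow> enat" where
  "parry_order \<beta> =
     (if pisot \<beta> \<or> salem \<beta> then \<infinity> else Sup {enat n | n. n \<ge> 1 \<and> parry (\<beta> ^ n)})"

definition H :: "nat \<Rightarrow> real set" where
  "H n = {\<beta>. perron \<beta> \<and> parry_order \<beta> = enat n}"

end

(* If beta is Perron, the conjugates of beta^n are exactly the n-th powers of the conjugates of beta,
   so beta^n is again Perron, and beta in H_n implies beta^n in H_1. The homeomorphism x -> x^n of
   (1, infinity) then transports density and limit points, which gives (2) and (3).

   For (1), a Parry number beta has no other conjugate z in (1, beta): the polynomial identities
   satisfied by the orbit of 1 pass to z, but the orbits computed at beta and at z drift apart
   monotonically. Hence a Perron number with a second real conjugate > 1 lies in H_0, and so do all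
   its powers. Such numbers exist arbitrarily close to 1: with y = X^n - 2X, the polynomial
   y^2 - 4y + 2 is Eisenstein at 2, its dominant root solves x^n = 2x + 2 + sqrt 2, and it has a
   second real root > 1 solving x^n = 2x + 2 - sqrt 2. Powers of numbers close to 1 are dense. *)
theory Submission
  imports Defs "Subresultants.Subresultant_Gcd" "Jordan_Normal_Form.Char_Poly"
    "Berlekamp_Zassenhaus.Factor_Bound"
begin

hide_const (open) up_ring.monom up_ring.coeff module.smult

section \<open>Evaluation of rational polynomials and transfer of relations between
  conjugates\<close>

definition rat_eval :: "complex \<Rightarrow> rat poly \<Rightarrow> complex" where
  "rat_eval x p = poly (map_poly of_rat p) x"

interpretation rat_eval: comm_ring_hom "rat_eval x"
proof -
  interpret map_poly_comm_ring_hom "of_rat :: rat \<Rightarrow> complex" ..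
  show "comm_ring_hom (rat_eval x)"
    by unfold_locales (simp_all add: rat_eval_def hom_add hom_mult)
qed

lemma rat_eval_pCons [simp]: "rat_eval x (pCons a p) = of_rat a + x * rat_eval x p"
  by (cases "pCons a p = 0") (auto simp: rat_eval_def map_poly_pCons)

lemma rat_eval_pcompose [simp]: "rat_eval x (p \<circ>\<^sub>p q) = rat_eval (rat_eval x q) p"
  by (induction p) (simp_all add: pcompose_pCons rat_eval.hom_add rat_eval.hom_mult)

lemma rat_eval_monom [simp]: "rat_eval x (monom 1 n) = x ^ n"
  by (simp add: rat_eval_def poly_monom)

lemma rat_eval_of_int_poly: "rat_eval x (of_int_poly p) = poly (of_int_poly p) x"
  by (induction p) (simp_all add: hom_distribs)

lemma galois_conjugate_iff:
  "galois_conjugate x z \<longleftrightarrow> (\<exists>p. irreducible p \<and> rat_eval x p = 0 \<and> rat_eval z p = 0)"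
  by (simp add: galois_conjugate_def rat_eval_def)

text \<open>Otherwise \<open>p\<close> and \<open>f\<close> are coprime, and evaluating a Bezout
  identity at the common root \<open>x\<close> gives 1 = 0.\<close>

lemma irreducible_dvd_of_root:
  assumes "irreducible p" "rat_eval x p = 0" "rat_eval x f = 0"
  shows "p dvd f"
proof (rule ccontr)
  assume "\<not> p dvd f"
  moreover have "prime_elem p"
    using assms(1) by (simp add: irreducible_imp_prime_elem)
  ultimately have "coprime p f"
    by (simp add: prime_elem_imp_coprime)
  then have "fst (bezout_coefficients p f) * p + snd (bezout_coefficients p f) * f = 1"
    by (simp add: bezout_coefficients_fst_snd)
  then have "rat_eval x 1 = 0"
    using assms(2,3) by (metis add.right_neutral mult_zero_right rat_eval.hom_add rat_eval.hom_mult)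
  then show False by simp
qed

text \<open>The irreducible polynomial witnessing the conjugacy divides \<open>f\<close>. Every
  later transfer of a rational relation from \<open>x\<close> to \<open>z\<close> goes through
  this.\<close>

lemma galois_conjugate_root:
  assumes "galois_conjugate x z" "rat_eval x f = 0"
  shows "rat_eval z f = 0"
proof -
  from assms obtain p where "irreducible p" "rat_eval x p = 0" "rat_eval z p = 0"
    by (auto simp: galois_conjugate_iff)
  with assms irreducible_dvd_of_root[of p x f] show ?thesis
    by (auto simp: dvd_def rat_eval.hom_mult)
qed

lemma ex_irreducible_of_root:
  assumes "f \<noteq> 0" "rat_eval x f = 0"
  shows "\<exists>p. irreducible p \<and> rat_eval x p = 0"
  using assms
proof (induction f rule: prime_divisors_induct)
  case zero then show ?case by simp
next
  case (unit f)
  then obtain c where "f = [:c:]" "c \<noteq> 0"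
    by (metis degree_eq_zeroE is_unit_iff_degree pCons_0_0)
  with unit show ?case by simp
next
  case (factor p f)
  then show ?case
    by (auto simp: rat_eval.hom_mult intro: prime_elem_imp_irreducible)
qed

lemma algebraic_int_ex_irreducible:
  assumes "algebraic_int x"
  shows "\<exists>p. irreducible p \<and> rat_eval x p = 0"
proof -
  from assms obtain f where "poly (of_int_poly f) x = 0" "lead_coeff f = 1"
    by (auto simp: algebraic_int_altdef_ipoly)
  then have "of_int_poly f \<noteq> (0 :: rat poly)" "rat_eval x (of_int_poly f) = 0"
    by (auto simp: rat_eval_of_int_poly)
  then show ?thesis by (rule ex_irreducible_of_root)
qed

section \<open>Powers of algebraic integers via integer matrices\<close>

text \<open>The characteristic polynomial of an integer matrix is monic with integer
  coefficients.\<close>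

lemma algebraic_int_eigenvalue:
  fixes A :: "int mat" and x :: "'a :: field_char_0"
  assumes "A \<in> carrier_mat d d" "eigenvalue (map_mat of_int A) x"
  shows "algebraic_int x"
  unfolding algebraic_int_altdef_ipoly
proof (intro exI conjI)
  show "lead_coeff (char_poly A) = 1"
    using degree_monic_char_poly[OF assms(1)] by simp
  show "poly (of_int_poly (char_poly A)) x = 0"
    using assms eigenvalue_root_char_poly[of "map_mat of_int A" d x]
    by (simp add: of_int_hom.char_poly_hom[OF assms(1)])
qed

(* The vector (1, x, ..., x^(d-1)) is an eigenvector of the companion matrix. *)
lemma algebraic_int_ex_eigenvector:
  fixes x :: "'a :: field_char_0"
  assumes "algebraic_int x"
  shows "\<exists>d (A :: int mat) v. A \<in> carrier_mat d d \<and> eigenvector (map_mat of_int A) v x"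
proof -
  from assms obtain f where f: "poly (of_int_poly f) x = 0" "lead_coeff f = 1"
    by (auto simp: algebraic_int_altdef_ipoly)
  define d where "d = degree f"
  have d: "d > 0"
  proof (rule ccontr)
    assume "\<not> d > 0"
    then obtain c where "f = [:c:]" unfolding d_def by (auto elim: degree_eq_zeroE)
    with f show False by simp
  qed
  define A :: "int mat" where
    "A = mat d d (\<lambda>(i, j). if Suc i = d then - coeff f j else if j = Suc i then 1 else 0)"
  define v where "v = vec d (\<lambda>i. x ^ i)"
  have A: "A \<in> carrier_mat d d" by (simp add: A_def)
  have x_pow: "(\<Sum>j<d. of_int (coeff f j) * x ^ j) = - (x ^ d)"
  proof -
    have "poly (of_int_poly f) x = (\<Sum>j\<le>d. of_int (coeff f j) * x ^ j)"
      by (simp add: poly_altdef d_def)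
    also have "\<dots> = (\<Sum>j<d. of_int (coeff f j) * x ^ j) + x ^ d"
      using f(2) by (simp add: d_def lessThan_Suc_atMost[symmetric])
    finally show ?thesis using f(1) by (simp add: eq_neg_iff_add_eq_0)
  qed
  have "map_mat of_int A *\<^sub>v v = x \<cdot>\<^sub>v v"
  proof (rule eq_vecI)
    fix i assume "i < dim_vec (x \<cdot>\<^sub>v v)"
    then have i: "i < d" by (simp add: v_def)
    have "(map_mat of_int A *\<^sub>v v) $ i = (\<Sum>j<d. of_int (A $$ (i, j)) * x ^ j)"
      using i A by (simp add: scalar_prod_def v_def atLeast0LessThan)
    also have "\<dots> = x ^ Suc i"
    proof (cases "Suc i = d")
      case True
      then have "(\<Sum>j<d. of_int (A $$ (i, j)) * x ^ j) = - (\<Sum>j<d. of_int (coeff f j) * x ^ j)"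
        using i by (simp add: A_def sum_negf)
      with x_pow True show ?thesis by simp
    next
      case False
      have "(\<Sum>j<d. of_int (A $$ (i, j)) * x ^ j) = (\<Sum>j<d. if j = Suc i then x ^ j else 0)"
        using i False by (intro sum.cong) (auto simp: A_def)
      with i False show ?thesis by simp
    qed
    also have "\<dots> = (x \<cdot>\<^sub>v v) $ i" using i by (simp add: v_def)
    finally show "(map_mat of_int A *\<^sub>v v) $ i = (x \<cdot>\<^sub>v v) $ i" .
  qed (simp add: A_def v_def)
  moreover have "v \<noteq> 0\<^sub>v d"
  proof
    assume "v = 0\<^sub>v d"
    then have "v $ 0 = 0" using d by simp
    then show False using d by (simp add: v_def)
  qed
  ultimately have "eigenvector (map_mat of_int A) v x"
    by (simp add: eigenvector_def v_def A_def)
  with A show ?thesis by blast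
qed

text \<open>If \<open>v\<close> is an eigenvector of the integer matrix \<open>A\<close> for
  \<open>x\<close>, it is one of the n-th power of \<open>A\<close> for
  \<open>x ^ n\<close>.\<close>

lemma algebraic_int_power:
  fixes x :: "'a :: field_char_0"
  assumes "algebraic_int x"
  shows "algebraic_int (x ^ n)"
proof -
  from algebraic_int_ex_eigenvector[OF assms] obtain d A v
    where A: "A \<in> carrier_mat d d" and v: "eigenvector (map_mat of_int A) v x" by blast
  have A': "map_mat of_int A \<in> carrier_mat d d" using A by simp
  have "map_mat of_int (A ^\<^sub>m n) *\<^sub>v v = x ^ n \<cdot>\<^sub>v v"
    using eigenvector_pow[OF A' v, of n] by (simp add: of_int_hom.mat_hom_pow[OF A])
  with v A have "eigenvector (map_mat of_int (A ^\<^sub>m n)) v (x ^ n)"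
    by (simp add: eigenvector_def)
  then show ?thesis
    using A by (intro algebraic_int_eigenvalue[of "A ^\<^sub>m n" d]) (auto simp: eigenvalue_def)
qed

section \<open>Conjugates of powers\<close>

text \<open>An irreducible \<open>p\<close> vanishing at \<open>x ^ n\<close>, composed with X^n,
  vanishes at \<open>x\<close> and hence at \<open>z\<close>.\<close>

lemma galois_conjugate_power:
  assumes "galois_conjugate x z" "algebraic_int x"
  shows "galois_conjugate (x ^ n) (z ^ n)"
proof -
  from algebraic_int_ex_irreducible[OF algebraic_int_power[OF assms(2)]]
  obtain p where p: "irreducible p" "rat_eval (x ^ n) p = 0" by blast
  then have "rat_eval x (p \<circ>\<^sub>p monom 1 n) = 0" by simp
  with assms have "rat_eval z (p \<circ>\<^sub>p monom 1 n) = 0" by (blast intro: galois_conjugate_root)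
  with p show ?thesis by (auto simp: galois_conjugate_iff)
qed

text \<open>The resultant vanishes exactly when the gcd is nonconstant, and over the complex numbers
  a nonconstant gcd has a root.\<close>

lemma resultant_eq_0_iff_common_root:
  fixes f g :: "complex poly"
  assumes "f \<noteq> 0"
  shows "resultant f g = 0 \<longleftrightarrow> (\<exists>w. poly f w = 0 \<and> poly g w = 0)"
proof
  assume "resultant f g = 0"
  then have "degree (gcd f g) \<noteq> 0" by (simp add: resultant_0_gcd)
  then obtain w where "poly (gcd f g) w = 0"
    using fundamental_theorem_of_algebra constant_degree by metis
  then show "\<exists>w. poly f w = 0 \<and> poly g w = 0"
    by (meson dvd_trans gcd_dvd1 gcd_dvd2 poly_eq_0_iff_dvd)
next
  assume "\<exists>w. poly f w = 0 \<and> poly g w = 0"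
  then obtain w where "[:- w, 1:] dvd gcd f g"
    by (auto simp: poly_eq_0_iff_dvd)
  then have "degree [:- w, 1:] \<le> degree (gcd f g)"
    using assms by (intro dvd_imp_degree_le) auto
  then show "resultant f g = 0" by (simp add: resultant_0_gcd)
qed

(* The resultant of m(X) and X^n - y is a rational polynomial in y whose roots are the n-th powers
   of the roots of m. *)
lemma galois_conjugate_of_power:
  assumes "galois_conjugate (x ^ n) z" "algebraic_int x" "n > 0"
  shows "\<exists>w. galois_conjugate x w \<and> w ^ n = z"
proof -
  from algebraic_int_ex_irreducible[OF assms(2)]
  obtain m where m: "irreducible m" "rat_eval x m = 0" by blast
  \<comment> \<open>Both arguments are polynomials in X over \<open>rat poly\<close>; the inner
    indeterminate plays the role of y, so \<open>[:[:0, 1:]:]\<close> is the constant y.\<close>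
  define R where "R = resultant (map_poly (\<lambda>a. [:a:]) m) (monom 1 n - [:[:0, 1:]:])"
  have R: "rat_eval y R = 0 \<longleftrightarrow> (\<exists>w. rat_eval w m = 0 \<and> w ^ n = y)" for y
  proof -
    interpret h: map_poly_comm_ring_hom "rat_eval y" ..
    have m': "map_poly (rat_eval y) (map_poly (\<lambda>a. [:a:]) m) = map_poly of_rat m"
      by (subst map_poly_map_poly) (auto simp: o_def)
    have "map_poly (rat_eval y) (monom 1 n - [:[:0, 1:]:])
        = map_poly (rat_eval y) (monom 1 n) - map_poly (rat_eval y) [:[:0, 1:]:]"
      by (rule h.hom_minus)
    then have q': "map_poly (rat_eval y) (monom 1 n - [:[:0, 1:]:]) = monom 1 n - [:y:]"
      by (simp add: map_poly_pCons)
    \<comment> \<open>Evaluation commutes with the resultant here because it preserves the degrees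
      of both arguments.\<close>
    have deg: "degree (monom 1 n - [:c:]) = n" for c :: "'b :: comm_ring_1"
    proof -
      have "degree (monom 1 n + [:- c:]) = degree (monom (1 :: 'b) n)"
        using assms(3) by (intro degree_add_eq_left) (simp add: degree_monom_eq)
      then show ?thesis
        by (simp add: degree_monom_eq diff_conv_add_uminus del: add_uminus_conv_diff)
    qed
    have "rat_eval y R = resultant (map_poly of_rat m) (monom 1 n - [:y:])"
      unfolding R_def m'[symmetric] q'[symmetric]
      by (rule rat_eval.resultant_map_poly[symmetric]) (simp add: m', simp only: q' deg)
    also have "\<dots> = 0 \<longleftrightarrow> (\<exists>w. rat_eval w m = 0 \<and> w ^ n = y)"
      using m(1) by (subst resultant_eq_0_iff_common_root)
        (auto simp: rat_eval_def poly_monom)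
    finally show ?thesis .
  qed
  from m have "rat_eval (x ^ n) R = 0" by (auto simp: R)
  with assms(1) have "rat_eval z R = 0" by (rule galois_conjugate_root)
  with m show ?thesis by (auto simp: R galois_conjugate_iff)
qed

section \<open>Perron numbers and the Parry order under powers\<close>

lemma perron_power:
  assumes "perron \<beta>" "n > 0"
  shows "perron (\<beta> ^ n)"
  unfolding perron_def
proof (intro conjI ballI)
  from assms have \<beta>: "algebraic_int \<beta>" "\<beta> > 0"
    and dom: "\<And>z. z \<in> other_conjugates \<beta> \<Longrightarrow> norm z < \<beta>"
    by (auto simp: perron_def)
  from \<beta> show "algebraic_int (\<beta> ^ n)" "\<beta> ^ n > 0"
    by (simp_all add: algebraic_int_power)
  fix z assume "z \<in> other_conjugates (\<beta> ^ n)"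
  then have z: "galois_conjugate (of_real \<beta> ^ n) z" "z \<noteq> of_real \<beta> ^ n"
    by (auto simp: other_conjugates_def)
  with galois_conjugate_of_power[OF z(1)] \<beta> assms(2)
  obtain w where w: "galois_conjugate (of_real \<beta>) w" "w ^ n = z" by auto
  with z have "w \<in> other_conjugates \<beta>" by (auto simp: other_conjugates_def)
  then have "norm w < \<beta>" by (rule dom)
  then have "norm z < \<beta> ^ n"
    using w(2) assms(2) power_strict_mono[of "norm w" \<beta> n] by (auto simp: norm_power)
  with \<beta> show "norm z < \<bar>\<beta> ^ n\<bar>" by simp
qed

text \<open>Strict dominance of \<beta> separates the norms of \<open>z ^ n\<close> and
  \<open>\<beta> ^ n\<close>, so the two powers cannot coincide.\<close>

lemma other_conjugates_power:
  assumes "perron \<beta>" "n > 0" "z \<in> other_conjugates \<beta>"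
  shows "z ^ n \<in> other_conjugates (\<beta> ^ n)"
proof -
  from assms have *: "algebraic_int \<beta>" "\<beta> > 0" "norm z < \<beta>" "galois_conjugate (of_real \<beta>) z"
    by (auto simp: perron_def other_conjugates_def)
  then have "norm (z ^ n) < \<beta> ^ n"
    using assms(2) power_strict_mono[of "norm z" \<beta> n] by (simp add: norm_power)
  then have "norm (z ^ n) \<noteq> norm (of_real (\<beta> ^ n) :: complex)"
    using *(2) by (simp add: norm_power)
  then have "z ^ n \<noteq> of_real (\<beta> ^ n)" by metis
  moreover have "galois_conjugate (of_real (\<beta> ^ n)) (z ^ n)"
    using galois_conjugate_power[OF *(4)] *(1) by simp
  ultimately show ?thesis by (simp add: other_conjugates_def)
qed

text \<open>The two classes differ only in whether the bound 1 is attained by some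
  conjugate.\<close>

lemma pisot_or_salem_iff:
  "pisot \<beta> \<or> salem \<beta> \<longleftrightarrow> algebraic_int \<beta> \<and> \<beta> > 1 \<and> (\<forall>z\<in>other_conjugates \<beta>. norm z \<le> 1)"
  unfolding pisot_def salem_def by (metis less_eq_real_def)

lemma pisot_or_salem_of_power:
  assumes "perron \<beta>" "n > 0" "pisot (\<beta> ^ n) \<or> salem (\<beta> ^ n)"
  shows "pisot \<beta> \<or> salem \<beta>"
  unfolding pisot_or_salem_iff
proof (intro conjI ballI)
  from assms(3) have *: "\<beta> ^ n > 1" "\<And>z. z \<in> other_conjugates (\<beta> ^ n) \<Longrightarrow> norm z \<le> 1"
    by (auto simp: pisot_or_salem_iff)
  from assms(1) show "algebraic_int \<beta>" by (simp add: perron_def)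
  from assms(1) have "\<beta> > 0" by (simp add: perron_def)
  with *(1) show "\<beta> > 1" by (meson less_eq_real_def linorder_not_less power_le_one)
  fix z assume "z \<in> other_conjugates \<beta>"
  with assms other_conjugates_power have "norm (z ^ n) \<le> 1" by (intro *(2)) auto
  then show "norm z \<le> 1"
    using assms(2) by (metis linorder_not_le norm_power one_less_power)
qed

text \<open>The exponent k for \<open>\<beta> ^ n\<close> is the exponent nk for \<beta>. As n is
  the largest exponent giving a Parry number, only k = 1 survives.\<close>

lemma parry_order_pos_power:
  assumes "perron \<beta>" "n > 0" "parry_order \<beta> = enat n"
  shows "parry_order (\<beta> ^ n) = enat 1"
proof -
  let ?S = "\<lambda>\<beta>. {enat n | n. n \<ge> 1 \<and> parry (\<beta> ^ n)}"
  from assms(3) have ps: "\<not> (pisot \<beta> \<or> salem \<beta>)" and Sup: "Sup (?S \<beta>) = enat n"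
    by (auto simp: parry_order_def split: if_splits)
  have upper: "m \<le> n" if "m \<ge> 1" "parry (\<beta> ^ m)" for m
    using Sup_upper[of "enat m" "?S \<beta>"] that Sup by auto
  \<comment> \<open>The supremum of the empty set is 0 in \<open>enat\<close>, whereas n is
    positive.\<close>
  have ne: "?S \<beta> \<noteq> {}"
    using Sup assms(2) by (auto simp: bot_enat_def zero_enat_def simp del: Collect_empty_eq)
  have "finite (?S \<beta>)"
  proof (rule finite_subset)
    show "?S \<beta> \<subseteq> enat ` {..n}" using upper by auto
  qed simp
  \<comment> \<open>A finite nonempty supremum in \<open>enat\<close> is a maximum, hence
    attained.\<close>
  with ne Sup have "enat n \<in> ?S \<beta>"
    using Max_in[of "?S \<beta>"] by (simp only: Sup_enat_def if_False if_True simp_thms)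
  then have "parry (\<beta> ^ n)" by auto
  have "?S (\<beta> ^ n) = {enat 1}"
  proof (rule Set.set_eqI)
    fix x
    have "k = 1" if "k \<ge> 1" "parry (\<beta> ^ (n * k))" for k
      using upper[of "n * k"] that assms(2) by (simp add: Suc_le_eq)
    then show "x \<in> ?S (\<beta> ^ n) \<longleftrightarrow> x \<in> {enat 1}"
      using \<open>parry (\<beta> ^ n)\<close> by (auto simp: power_mult[symmetric])
  qed
  then have "Sup (?S (\<beta> ^ n)) = enat 1" by (simp only: cSup_singleton)
  moreover have "\<not> (pisot (\<beta> ^ n) \<or> salem (\<beta> ^ n))"
    using pisot_or_salem_of_power[OF assms(1,2)] ps by blast
  ultimately show ?thesis by (simp add: parry_order_def)
qed

lemma H_power: "\<beta> \<in> H n \<Longrightarrow> n > 0 \<Longrightarrow> \<beta> ^ n \<in> H 1"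
  by (simp add: H_def perron_power parry_order_pos_power)

text \<open>A positive order provides a Parry power of \<beta>, which exceeds 1 by definition. This
  bounds limit points of \<open>H n\<close> from below.\<close>

lemma H_gt_1:
  assumes "\<beta> \<in> H n" "n > 0"
  shows "\<beta> > 1"
proof -
  have "\<beta> > 0" using assms by (simp add: H_def perron_def)
  from H_power[OF assms] have "parry_order (\<beta> ^ n) = enat 1" by (simp add: H_def)
  then have "{enat k | k. k \<ge> 1 \<and> parry ((\<beta> ^ n) ^ k)} \<noteq> {}"
    by (auto simp: parry_order_def bot_enat_def zero_enat_def simp del: Collect_empty_eq
        split: if_splits)
  then obtain k where "\<beta> ^ (n * k) > 1" by (auto simp: parry_def power_mult)
  with \<open>\<beta> > 0\<close> show ?thesis by (meson less_eq_real_def linorder_not_less power_le_one)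
qed

section \<open>The orbit of 1 and real conjugates of Parry numbers\<close>

text \<open>A Horner scheme whose coefficients are the digits of the \<beta>-expansion of 1. The
  digits stay fixed, so the orbit becomes a polynomial that can also be evaluated at a
  conjugate.\<close>

primrec orbit_poly :: "real \<Rightarrow> nat \<Rightarrow> rat poly" where
  "orbit_poly \<beta> 0 = 1"
| "orbit_poly \<beta> (Suc k) = pCons (- of_int \<lfloor>\<beta> * (beta_map \<beta> ^^ k) 1\<rfloor>) (orbit_poly \<beta> k)"

lemma rat_eval_orbit_poly: "rat_eval (of_real \<beta>) (orbit_poly \<beta> k) = of_real ((beta_map \<beta> ^^ k) 1)"
proof (induction k)
  case (Suc k)
  then show ?case by (simp add: beta_map_def[of _ "(beta_map \<beta> ^^ k) 1"] frac_def of_rat_minus)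
qed simp

(* If r_k is the orbit of 1 under the beta-map and R_k the polynomial expressing it, then
   e_k = R_k(\<beta>) - R_k(z) satisfies e_(k+1) = z e_k + (\<beta> - z) r_k, so it is strictly increasing,
   whereas r_i = r_j would force e_i = e_j by conjugation. *)
lemma parry_no_conjugate_between:
  assumes "parry \<beta>" "1 < z" "z < \<beta>"
  shows "\<not> galois_conjugate (of_real \<beta>) (of_real z)"
proof
  assume conj: "galois_conjugate (of_real \<beta>) (of_real z)"
  define r where "r k = (beta_map \<beta> ^^ k) 1" for k
  define e where "e k = Re (rat_eval (of_real \<beta>) (orbit_poly \<beta> k) - rat_eval (of_real z) (orbit_poly \<beta> k))" for k
  have r_nonneg: "r k \<ge> 0" for k
    by (cases k) (simp_all add: r_def beta_map_def)
  have e_Suc: "e (Suc k) = z * e k + (\<beta> - z) * r k" for k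
  proof -
    have "e (Suc k) = \<beta> * Re (rat_eval (of_real \<beta>) (orbit_poly \<beta> k))
        - z * Re (rat_eval (of_real z) (orbit_poly \<beta> k))"
      by (simp add: e_def)
    then show ?thesis
      by (simp add: e_def rat_eval_orbit_poly r_def algebra_simps)
  qed
  \<comment> \<open>The drift starts from \<open>e 0 = 0\<close> and \<open>r 0 = 1\<close>, so
    \<open>e 1 = \<beta> - z > 0\<close>; from then on the factor z > 1 suffices, since
    \<open>r k\<close> is nonnegative.\<close>
  have e_mono: "e k < e (Suc k) \<and> e k \<ge> 0" for k
  proof (induction k)
    case 0
    then show ?case using assms by (simp add: e_Suc) (simp add: e_def r_def)
  next
    case (Suc k)
    then have "e (Suc k) > 0" by simp
    then have "e (Suc k) < z * e (Suc k)" using assms by simp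
    also have "\<dots> \<le> e (Suc (Suc k))" using e_Suc[of "Suc k"] r_nonneg[of "Suc k"] assms by simp
    finally show ?case using \<open>e (Suc k) > 0\<close> by simp
  qed
  then have "strict_mono e" by (simp add: strict_mono_Suc_iff)
  have "inj r"
  proof (rule injI)
    fix i j assume "r i = r j"
    then have *: "rat_eval (of_real \<beta>) (orbit_poly \<beta> i - orbit_poly \<beta> j) = 0"
      by (simp add: rat_eval.hom_minus rat_eval_orbit_poly r_def)
    from galois_conjugate_root[OF conj this] *
    have "e i = e j" by (simp add: e_def rat_eval.hom_minus)
    with \<open>strict_mono e\<close> show "i = j" by (simp add: strict_mono_eq)
  qed
  then have "infinite (r ` {1..})"
    by (simp add: finite_image_iff inj_on_subset infinite_Ici)
  moreover have "r ` {1..} = {(beta_map \<beta> ^^ k) 1 | k. k \<ge> 1}"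
    by (auto simp: r_def)
  ultimately show False using assms(1) by (simp add: parry_def)
qed

section \<open>A sufficient condition for membership in \<open>H 0\<close>\<close>

text \<open>This condition excludes Parry, Pisot and Salem numbers and is inherited by positive
  powers, so one such number yields a whole sequence in \<open>H 0\<close>.\<close>

definition perron_with_conjugate_gt_1 :: "real \<Rightarrow> bool" where
  "perron_with_conjugate_gt_1 \<beta> \<longleftrightarrow> perron \<beta> \<and> (\<exists>z>1. of_real z \<in> other_conjugates \<beta>)"

lemma perron_with_conjugate_gt_1_power:
  assumes "perron_with_conjugate_gt_1 \<beta>" "n > 0"
  shows "perron_with_conjugate_gt_1 (\<beta> ^ n)"
proof -
  from assms obtain z where z: "perron \<beta>" "z > 1" "of_real z \<in> other_conjugates \<beta>"
    by (auto simp: perron_with_conjugate_gt_1_def)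
  then have "of_real (z ^ n) \<in> other_conjugates (\<beta> ^ n)"
    using other_conjugates_power[OF z(1) assms(2) z(3)] by simp
  moreover have "z ^ n > 1" using z(2) assms(2) by simp
  ultimately show ?thesis
    using perron_power[OF z(1) assms(2)] unfolding perron_with_conjugate_gt_1_def by blast
qed

lemma perron_with_conjugate_gt_1_not_parry:
  assumes "perron_with_conjugate_gt_1 \<beta>"
  shows "\<not> parry \<beta>"
proof
  assume "parry \<beta>"
  from assms obtain z where z: "perron \<beta>" "z > 1" "of_real z \<in> other_conjugates \<beta>"
    by (auto simp: perron_with_conjugate_gt_1_def)
  then have "z < \<beta>" by (auto simp: perron_def dest!: bspec)
  with parry_no_conjugate_between[OF \<open>parry \<beta>\<close>] z show False
    by (auto simp: other_conjugates_def)
qed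

lemma perron_with_conjugate_gt_1_in_H_0:
  assumes "perron_with_conjugate_gt_1 \<beta>"
  shows "\<beta> \<in> H 0"
proof -
  from assms obtain z where z: "perron \<beta>" "z > 1" "of_real z \<in> other_conjugates \<beta>"
    by (auto simp: perron_with_conjugate_gt_1_def)
  from z(2) have "\<not> norm (complex_of_real z) \<le> 1" by simp
  with z(3) have "\<not> (pisot \<beta> \<or> salem \<beta>)" unfolding pisot_or_salem_iff by blast
  moreover have "\<not> parry (\<beta> ^ n)" if "n \<ge> 1" for n
    using assms that
    by (intro perron_with_conjugate_gt_1_not_parry perron_with_conjugate_gt_1_power) simp_all
  then have "{enat n | n. n \<ge> 1 \<and> parry (\<beta> ^ n)} = {}" by auto
  ultimately have "parry_order \<beta> = enat 0"
    unfolding parry_order_def by (simp only: if_False Sup_empty) (simp add: bot_enat_def zero_enat_def)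
  with z show ?thesis by (simp add: H_def)
qed

section \<open>Eisenstein's criterion\<close>

text \<open>Take the least i with \<open>coeff g i\<close> not divisible by p. In the i-th
  coefficient of \<open>g * h\<close> every term except \<open>coeff g i * coeff h 0\<close> is
  divisible by p, yet so is the sum.\<close>

lemma eisenstein_aux:
  fixes g h :: "int poly"
  assumes "prime p" and "p dvd coeff g 0" and "\<not> p dvd coeff h 0"
    and "\<not> p dvd lead_coeff (g * h)" and "\<And>i. i < degree (g * h) \<Longrightarrow> p dvd coeff (g * h) i"
    and "degree g < degree (g * h)"
  shows False
proof -
  have "\<not> p dvd coeff g (degree g)"
    using assms(4) by (auto simp: lead_coeff_mult)
  define i where "i = (LEAST i. \<not> p dvd coeff g i)"
  have i: "\<not> p dvd coeff g i"
    unfolding i_def by (rule LeastI, fact)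
  have "i \<le> degree g" unfolding i_def by (rule Least_le, fact)
  have less: "p dvd coeff g j" if "j < i" for j
    using not_less_Least[of j "\<lambda>i. \<not> p dvd coeff g i"] that by (auto simp: i_def)
  have "coeff (g * h) i = (\<Sum>j<i. coeff g j * coeff h (i - j)) + coeff g i * coeff h 0"
    by (simp add: coeff_mult lessThan_Suc_atMost[symmetric])
  moreover have "p dvd coeff (g * h) i"
    using \<open>i \<le> degree g\<close> assms(6) by (intro assms(5)) simp
  moreover have "p dvd (\<Sum>j<i. coeff g j * coeff h (i - j))"
    by (intro dvd_sum) (simp add: less)
  ultimately have "p dvd coeff g i * coeff h 0"
    by (simp add: dvd_add_right_iff)
  with assms(1,3) i show False by (simp add: prime_dvd_mult_iff)
qed

text \<open>In a factorization into lower degrees, p divides exactly one of the two constant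
  coefficients; \<open>eisenstein_aux\<close> refutes either case.\<close>

lemma eisenstein_criterion:
  fixes f :: "int poly"
  assumes "prime p" and "degree f > 0" and "\<not> p dvd lead_coeff f"
    and "\<And>i. i < degree f \<Longrightarrow> p dvd coeff f i" and "\<not> p\<^sup>2 dvd coeff f 0"
  shows "irreducible (map_poly rat_of_int f)"
proof -
  have "irreducible\<^sub>d f"
  proof (rule irreducible\<^sub>dI)
    fix g h assume gh: "degree g < degree f" "degree h < degree f" "f = g * h"
    have coeff_0: "coeff f 0 = coeff g 0 * coeff h 0"
      using gh(3) by (simp add: coeff_mult_0)
    with assms(1,2) assms(4)[of 0] have "p dvd coeff g 0 \<or> p dvd coeff h 0"
      by (simp add: prime_dvd_mult_iff)
    moreover have "\<not> (p dvd coeff g 0 \<and> p dvd coeff h 0)"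
      using assms(5) coeff_0 by (auto simp: power2_eq_square mult_dvd_mono)
    ultimately show False
      using eisenstein_aux[of p g h] eisenstein_aux[of p h g] assms(1,3,4) gh
      by (auto simp: mult.commute)
  qed (fact assms(2))
  \<comment> \<open>Gauss's lemma: no factorization into lower degrees over the integers means none
    over the rationals.\<close>
  then have "irreducible\<^sub>d (map_poly rat_of_int f)" by (rule irreducible\<^sub>d_int_rat)
  then show ?thesis by simp
qed

section \<open>Perron numbers close to 1\<close>

definition near_1_poly :: "nat \<Rightarrow> int poly" where
  "near_1_poly n = ([:0, 1:] ^ n - [:0, 2:])\<^sup>2 - [:4:] * ([:0, 1:] ^ n - [:0, 2:]) + [:2:]"

text \<open>In this form the leading monomial stands apart and 2 is factored out of the rest, as
  Eisenstein at 2 requires; the constant term is 2.\<close>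

lemma near_1_poly_altdef:
  "near_1_poly n = monom 1 (2 * n) +
    smult 2 ([:1, 4, 2:] - smult 2 (monom 1 n) - smult 2 (monom 1 (Suc n)))"
  (is "_ = _ + smult 2 ?g")
proof -
  have "poly (near_1_poly n) x = poly (monom 1 (2 * n) + smult 2 ?g) x" for x
  proof -
    have "x ^ (2 * n) = x ^ n * x ^ n" by (simp add: mult_2 power_add)
    then show ?thesis
      by (simp add: near_1_poly_def poly_monom power2_eq_square algebra_simps)
  qed
  then have "poly (near_1_poly n) = poly (monom 1 (2 * n) + smult 2 ?g)" by (rule ext)
  then show ?thesis by (simp only: poly_eq_poly_eq_iff)
qed

lemma lead_coeff_near_1_poly:
  assumes "n \<ge> 2"
  shows "degree (near_1_poly n) = 2 * n" "lead_coeff (near_1_poly n) = 1"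
proof -
  let ?g = "[:1, 4, 2:] - smult 2 (monom 1 n) - smult 2 (monom 1 (Suc n)) :: int poly"
  \<comment> \<open>The largest exponent in \<open>?g\<close> is at most n + 1, which is below 2n
    because n is at least 2.\<close>
  have "degree ?g < 2 * n"
    using assms by (intro degree_diff_less) (auto simp: degree_monom_eq)
  then show deg: "degree (near_1_poly n) = 2 * n"
    unfolding near_1_poly_altdef
    by (subst degree_add_eq_left) (auto simp: degree_monom_eq)
  from \<open>degree ?g < 2 * n\<close> show "lead_coeff (near_1_poly n) = 1"
    unfolding deg unfolding near_1_poly_altdef
    using coeff_eq_0[of ?g "2 * n"] by simp
qed

lemma irreducible_near_1_poly:
  assumes "n \<ge> 2"
  shows "irreducible (map_poly rat_of_int (near_1_poly n))"
proof (rule eisenstein_criterion)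
  show "prime (2 :: int)" by simp
  show "degree (near_1_poly n) > 0" "\<not> 2 dvd lead_coeff (near_1_poly n)"
    unfolding lead_coeff_near_1_poly(2)[OF assms]
    using assms by (simp_all add: lead_coeff_near_1_poly(1))
  fix i assume "i < degree (near_1_poly n)"
  then have "coeff (monom 1 (2 * n)) i = (0 :: int)"
    using assms by (simp add: lead_coeff_near_1_poly)
  then show "2 dvd coeff (near_1_poly n) i"
    unfolding near_1_poly_altdef by simp
next
  have "coeff (near_1_poly n) 0 = 2"
    unfolding near_1_poly_altdef using assms by simp
  then show "\<not> 2\<^sup>2 dvd coeff (near_1_poly n) 0" by simp
qed

text \<open>Completing the square, y^2 - 4y + 2 = (y - 2)^2 - 2 with y = z^n - 2z, so y is 2 + sqrt
  2 or 2 - sqrt 2.\<close>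

lemma poly_near_1_poly:
  fixes z :: complex
  shows "poly (of_int_poly (near_1_poly n)) z = 0 \<longleftrightarrow>
    z ^ n = 2 * z + of_real (2 + sqrt 2) \<or> z ^ n = 2 * z + of_real (2 - sqrt 2)"
proof -
  let ?w = "z ^ n - 2 * z - 2"
  have "(of_real (sqrt 2) :: complex)\<^sup>2 = 2"
    by (simp only: of_real_power[symmetric]) simp
  then have "?w\<^sup>2 - 2 = (?w - of_real (sqrt 2)) * (?w + of_real (sqrt 2))"
    by (simp add: power2_eq_square algebra_simps)
  moreover have "poly (of_int_poly (near_1_poly n)) z = ?w\<^sup>2 - 2"
    unfolding near_1_poly_def of_int_poly_hom.hom_add of_int_poly_hom.hom_minus
      of_int_poly_hom.hom_mult of_int_poly_hom.hom_power poly_add poly_diff poly_mult poly_power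
    by (simp add: power2_eq_square algebra_simps)
  ultimately have "poly (of_int_poly (near_1_poly n)) z = 0 \<longleftrightarrow>
      ?w - of_real (sqrt 2) = 0 \<or> ?w + of_real (sqrt 2) = 0"
    by simp
  then show ?thesis by (auto simp: algebra_simps)
qed

(* Comparing |z|^n <= a|z| + c with the equation of \<beta> gives |z| <= \<beta>; equality forces equality in
   the triangle inequality, hence z = \<beta>. *)
lemma dominant_root:
  fixes \<beta> a b c :: real and z :: complex
  assumes "n \<ge> 2" "\<beta> > 0" "a > 0" "0 < c" "c \<le> b" "\<beta> ^ n = a * \<beta> + b" "z ^ n = of_real a * z + of_real c"
  shows "norm z < \<beta> \<or> z = of_real \<beta>"
proof (rule disjCI)
  assume "z \<noteq> of_real \<beta>"
  show "norm z < \<beta>"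
  proof (rule ccontr)
    assume "\<not> norm z < \<beta>"
    then have ge: "norm z \<ge> \<beta>" by simp
    define x where "x = norm z"
    obtain m where n: "n = Suc m" "m > 0" using assms(1) by (cases n) auto
    have tri: "x ^ n \<le> a * x + c"
      using norm_triangle_ineq[of "of_real a * z" "of_real c"] assms(3,4)
      by (simp add: x_def norm_mult assms(7)[symmetric] norm_power)
    \<comment> \<open>If x > \<beta>, then x^m > \<beta>^m = a + b/\<beta> > a + b/x, contradicting
      \<open>tri\<close>. The steps below are this argument with denominators cleared.\<close>
    have "x = \<beta>"
    proof (rule ccontr)
      assume "x \<noteq> \<beta>"
      with ge have "x > \<beta>" by (simp add: x_def)
      then have "x ^ m > \<beta> ^ m" using n assms(2) by (intro power_strict_mono) auto
      then have "x * x ^ m > x * \<beta> ^ m" using \<open>x > \<beta>\<close> assms(2) by simp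
      moreover have "\<beta> * (x * \<beta> ^ m) = x * (a * \<beta> + b)"
        using assms(6) n by (simp add: ac_simps)
      moreover have "\<beta> * (a * x + b) \<le> x * (a * \<beta> + b)"
        using \<open>x > \<beta>\<close> assms by (simp add: algebra_simps)
      ultimately have "\<beta> * (x * x ^ m) > \<beta> * (a * x + b)"
        using mult_strict_left_mono[of "x * \<beta> ^ m" "x * x ^ m" \<beta>] assms(2) by linarith
      with tri assms(2,5) show False by (simp add: n)
    qed
    with tri assms(5,6) have "c = b" by simp
    \<comment> \<open>Expanding the squared norms leaves only the cross term 2ab Re z, which forces
      \<open>Re z = \<beta>\<close>.\<close>
    have "norm (of_real a * z + of_real b) = a * \<beta> + b"
      using assms(6,7) \<open>c = b\<close> \<open>x = \<beta>\<close> by (metis norm_power x_def)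
    then have "(a * Re z + b)\<^sup>2 + (a * Im z)\<^sup>2 = (a * \<beta> + b)\<^sup>2"
      using cmod_power2[of "of_real a * z + of_real b"] by simp
    moreover have "(a * Re z + b)\<^sup>2 + (a * Im z)\<^sup>2 =
        a\<^sup>2 * ((Re z)\<^sup>2 + (Im z)\<^sup>2) + 2 * a * b * Re z + b\<^sup>2"
      by (simp add: power2_eq_square algebra_simps)
    moreover have norm: "(Re z)\<^sup>2 + (Im z)\<^sup>2 = \<beta>\<^sup>2"
      using \<open>x = \<beta>\<close> cmod_power2[of z] by (simp add: x_def)
    moreover have "(a * \<beta> + b)\<^sup>2 = a\<^sup>2 * \<beta>\<^sup>2 + 2 * a * b * \<beta> + b\<^sup>2"
      by (simp add: power2_eq_square algebra_simps)
    ultimately have "2 * a * b * Re z = 2 * a * b * \<beta>" by simp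
    then have "Re z = \<beta>" using assms(3,4) \<open>c = b\<close> by simp
    with norm have "Im z = 0" by simp
    with \<open>Re z = \<beta>\<close> \<open>z \<noteq> of_real \<beta>\<close> show False by (simp add: complex_eq_iff)
  qed
qed

lemma ex_perron_with_conjugate_gt_1:
  assumes "\<epsilon> > 0"
  shows "\<exists>\<beta>. perron_with_conjugate_gt_1 \<beta> \<and> 1 < \<beta> \<and> \<beta> < 1 + \<epsilon>"
proof -
  define b where "b = 2 + sqrt 2"
  define c where "c = 2 - sqrt 2"
  have bc: "0 < c" "c < b" "b > 0"
    using sqrt2_less_2 by (auto simp: b_def c_def add_pos_pos)
  \<comment> \<open>With this n, x^n - 2x - b is negative at 1 and positive at 1 + \<epsilon>, which
    places \<beta> between them.\<close>
  obtain n where n: "2 * (1 + \<epsilon>) + b < (1 + \<epsilon>) ^ n"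
    using real_arch_pow[of "1 + \<epsilon>" "2 * (1 + \<epsilon>) + b"] assms by auto
  have "n \<ge> 2"
  proof (rule ccontr)
    assume "\<not> n \<ge> 2"
    then have "n = 0 \<or> n = 1" by auto
    with n bc assms show False by auto
  qed
  have root: "\<exists>x. u < x \<and> x < v \<and> x ^ n = 2 * x + q"
    if "u ^ n < 2 * u + q" "2 * v + q < v ^ n" "u < v" for u v q :: real
  proof -
    have "\<exists>x\<ge>u. x \<le> v \<and> x ^ n - 2 * x = q"
      using that by (intro IVT' continuous_intros) simp_all
    then obtain x where x: "u \<le> x" "x \<le> v" "x ^ n = 2 * x + q" by auto
    with that have "x \<noteq> u" "x \<noteq> v" by auto
    with x show ?thesis by (auto simp: less_le)
  qed
  have "\<exists>x>1. x < 1 + \<epsilon> \<and> x ^ n = 2 * x + b"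
    by (rule root) (use n bc assms in simp_all)
  then obtain \<beta> where \<beta>: "1 < \<beta>" "\<beta> < 1 + \<epsilon>" "\<beta> ^ n = 2 * \<beta> + b" by auto
  \<comment> \<open>At \<beta> the value \<beta>^n = 2\<beta> + b exceeds 2\<beta> + c, so the
    equation with c has a root below \<beta>.\<close>
  have "\<exists>x>1. x < \<beta> \<and> x ^ n = 2 * x + c"
    by (rule root) (use \<beta> bc in simp_all)
  then obtain z where z: "1 < z" "z < \<beta>" "z ^ n = 2 * z + c" by auto
  define P where "P = map_poly rat_of_int (near_1_poly n)"
  have eval: "rat_eval w P = 0 \<longleftrightarrow> w ^ n = 2 * w + of_real b \<or> w ^ n = 2 * w + of_real c" for w
    unfolding P_def rat_eval_of_int_poly poly_near_1_poly b_def c_def ..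
  have \<beta>_root: "rat_eval (of_real \<beta>) P = 0"
    unfolding eval using arg_cong[OF \<beta>(3), of complex_of_real] by simp
  have "perron \<beta>"
    unfolding perron_def
  proof (intro conjI ballI)
    have "algebraic_int (complex_of_real \<beta>)"
      unfolding algebraic_int_altdef_ipoly
      using \<beta>_root lead_coeff_near_1_poly[OF \<open>n \<ge> 2\<close>] by (auto simp: P_def rat_eval_of_int_poly)
    then show "algebraic_int \<beta>" by simp
    show "\<beta> > 0" using \<beta> by simp
    fix w assume "w \<in> other_conjugates \<beta>"
    then have w: "w \<noteq> of_real \<beta>" "galois_conjugate (of_real \<beta>) w" by (auto simp: other_conjugates_def)
    from galois_conjugate_root[OF w(2) \<beta>_root]
    have "w ^ n = 2 * w + of_real b \<or> w ^ n = 2 * w + of_real c"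
      unfolding eval .
    then have "norm w < \<beta> \<or> w = of_real \<beta>"
    proof
      assume *: "w ^ n = 2 * w + of_real b"
      show ?thesis by (rule dominant_root[of n \<beta> 2 b b]) (use bc \<beta> * \<open>n \<ge> 2\<close> in simp_all)
    next
      assume *: "w ^ n = 2 * w + of_real c"
      show ?thesis by (rule dominant_root[of n \<beta> 2 c b]) (use bc \<beta> * \<open>n \<ge> 2\<close> in simp_all)
    qed
    with w(1) \<beta>(1) show "norm w < \<bar>\<beta>\<bar>" by simp
  qed
  moreover have "rat_eval (of_real z) P = 0"
    unfolding eval using arg_cong[OF z(3), of complex_of_real] by simp
  then have "of_real z \<in> other_conjugates \<beta>"
    using \<beta>_root irreducible_near_1_poly[OF \<open>n \<ge> 2\<close>] z(2)
    by (auto simp: other_conjugates_def galois_conjugate_iff P_def)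
  ultimately show ?thesis
    using z(1) \<beta> unfolding perron_with_conjugate_gt_1_def by blast
qed

section \<open>Density and limit points\<close>

text \<open>The largest power of u not exceeding x works; its exponent is positive because u itself
  does not exceed x.\<close>

lemma ex_power_near:
  fixes u x :: real
  assumes "1 < u" "u \<le> x"
  shows "\<exists>k>0. u ^ k \<le> x \<and> x < u * u ^ k"
proof -
  define k where "k = (LEAST k. x < u ^ k)"
  have k: "x < u ^ k"
    unfolding k_def using real_arch_pow[OF assms(1)] by (rule LeastI_ex)
  have "\<not> x < u ^ 0" "\<not> x < u ^ 1" using assms by simp_all
  with k have "k \<noteq> 0" "k \<noteq> 1" by metis+
  then obtain j where j: "k = Suc j" "j > 0" by (cases k) auto
  have "u ^ j \<le> x"
    using not_less_Least[of j "\<lambda>k. x < u ^ k"] j by (simp add: k_def)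
  with k j show ?thesis by auto
qed

lemma H_0_dense: "{1<..} \<subseteq> closure (H 0)"
proof
  fix x :: real assume "x \<in> {1<..}"
  then have x: "x > 1" by simp
  show "x \<in> closure (H 0)"
    unfolding closure_approachable
  proof (intro allI impI)
    fix e :: real assume "e > 0"
    \<comment> \<open>The bound \<open>x - 1\<close> ensures \<open>u \<le> x\<close>; the bound
      \<open>e / x\<close> makes the gap x - u^k, which is below (u - 1)x, smaller than e.\<close>
    define \<epsilon> where "\<epsilon> = min (x - 1) (e / x)"
    have "\<epsilon> > 0" using x \<open>e > 0\<close> by (simp add: \<epsilon>_def)
    then obtain u where u: "perron_with_conjugate_gt_1 u" "1 < u" "u < 1 + \<epsilon>"
      using ex_perron_with_conjugate_gt_1 by blast
    have "u \<le> x" using u(3) by (simp add: \<epsilon>_def)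
    with ex_power_near u(2) obtain k where k: "k > 0" "u ^ k \<le> x" "x < u * u ^ k" by blast
    have "x - u ^ k < (u - 1) * u ^ k" using k by (simp add: algebra_simps)
    also have "\<dots> \<le> (u - 1) * x" using k u by simp
    also have "\<dots> < \<epsilon> * x" using u x by simp
    also have "\<dots> \<le> e / x * x" using x by (intro mult_right_mono) (auto simp: \<epsilon>_def)
    also have "\<dots> = e" using x by simp
    finally have "dist (u ^ k) x < e" using k by (simp add: dist_real_def)
    moreover have "u ^ k \<in> H 0"
      using u k by (intro perron_with_conjugate_gt_1_in_H_0 perron_with_conjugate_gt_1_power)
    ultimately show "\<exists>y\<in>H 0. dist y x < e" by blast
  qed
qed

text \<open>The n-th power map is continuous, so it sends the closure of \<open>H n\<close> into the
  closure of \<open>H 1\<close>, and it reaches x from \<open>root n x\<close>.\<close>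

lemma H_1_dense:
  assumes "n \<ge> 1" "{1<..} \<subseteq> closure (H n)"
  shows "{1<..} \<subseteq> closure (H 1)"
proof
  fix x :: real assume "x \<in> {1<..}"
  then have "root n x \<in> {1<..}" using assms(1) by simp
  with assms(2) have "root n x \<in> closure (H n)" by blast
  then have "root n x ^ n \<in> (\<lambda>\<beta>. \<beta> ^ n) ` closure (H n)" by blast
  also have "\<dots> \<subseteq> closure ((\<lambda>\<beta>. \<beta> ^ n) ` H n)"
    by (rule continuous_image_closure_subset[OF _ subset_UNIV]) (auto intro: continuous_intros)
  also have "\<dots> \<subseteq> closure (H 1)"
    using assms(1) H_power by (intro closure_mono) auto
  finally show "x \<in> closure (H 1)" using \<open>x \<in> {1<..}\<close> assms(1) by simp
qed

text \<open>Raise a sequence in \<open>H n\<close> converging to x to the n-th power. Its terms stay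
  different from x^n because the power map is injective on nonnegative reals and x is at least
  1.\<close>

lemma islimpt_H_power:
  assumes "n \<ge> 1" "x islimpt H n"
  shows "x ^ n islimpt H 1"
proof -
  from assms(2) obtain f where f: "\<And>k. f k \<in> H n - {x}" "f \<longlonglongrightarrow> x"
    by (auto simp: islimpt_sequential)
  have gt: "f k > 1" for k using H_gt_1[of "f k" n] f(1)[of k] assms(1) by simp
  then have "x \<ge> 1" using f(2) by (intro LIMSEQ_le_const) (auto intro: less_imp_le)
  have "f k ^ n \<noteq> x ^ n" for k
    using f(1)[of k] gt[of k] \<open>x \<ge> 1\<close> assms(1) power_eq_imp_eq_base[of "f k" n x] by auto
  then have "\<forall>k. f k ^ n \<in> H 1 - {x ^ n}"
    using f(1) H_power assms(1) by auto
  moreover have "(\<lambda>k. f k ^ n) \<longlonglongrightarrow> x ^ n" by (intro tendsto_intros f(2))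
  ultimately show ?thesis by (auto simp: islimpt_sequential)
qed

theorem theorem2p12:
  shows "{1<..} \<subseteq> closure (H 0)
    \<and> ((\<exists>n\<ge>1. {1<..} \<subseteq> closure (H n)) \<longrightarrow> {1<..} \<subseteq> closure (H 1))
    \<and> (\<not> (\<exists>x. x islimpt H 1) \<longrightarrow> (\<forall>n\<ge>1. \<not> (\<exists>x. x islimpt H n)))"
  using H_0_dense H_1_dense islimpt_H_power by blast

end
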